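(* Let $m\in\mathbb{C}$ and let $(x,y)\in\mathbb{H}^+$ be fixed. Then $$E_m(x,y,\xi,\eta)\;\sim\;\frac{1}{2\pi}\ln\sqrt{(x-\xi)^2+(y-\eta)^2}\qquad\text{as }(\xi,\eta)\to(x,y).$$
   Context: $\mathbb{H}^+=\{(x,y)\in\mathbb{R}^2: x>0\}$. Complex powers of positive reals are $t^{s}=\exp(s\ln t)$. For $(x,y)\ne(\xi,\eta)$ in $\mathbb{H}^+$: if $\operatorname{Re} m\ge1$, $$E_m(x,y,\xi,\eta)=-\frac{\xi^m}{2\pi}\int_0^{\pi}\frac{\sin^{m-1}\theta\,d\theta}{\left[(x-\xi)^2+4x\xi\sin^2\left(\frac{\theta}{2}\right)+(y-\eta)^2\right]^{m/2}},$$ and if $\operatorname{Re} m<1$, $$E_m(x,y,\xi,\eta)=-\frac{\xi x^{1-m}}{2\pi}\int_0^{\pi}\frac{\sin^{1-m}\theta\,d\theta}{\left[(x-\xi)^2+4x\xi\sin^2\left(\frac{\theta}{2}\right)+(y-\eta)^2\right]^{1-\frac m2}}.$$ The notation $f\sim g$ means that $f/g\to1$. *)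

theory Defs
  imports "HOL-Analysis.Analysis" "HOL-Library.Landau_Symbols"
begin

definition half_plane :: "(real \<times> real) set" where
  "half_plane = {(x, y). x > 0}"

definition bracket :: "real \<Rightarrow> real \<Rightarrow> real \<Rightarrow> real \<Rightarrow> real \<Rightarrow> real" where
  "bracket x y \<xi> \<eta> \<theta> = (x - \<xi>)\<^sup>2 + 4 * x * \<xi> * (sin (\<theta> / 2))\<^sup>2 + (y - \<eta>)\<^sup>2"

text \<open>
  Intended for distinct points (x, y), (\<xi>, \<eta>) of the half-plane; elsewhere the values are
  arbitrary. All powers have positive real bases for 0 < \<theta> < pi, where complex powr is
  t powr s = exp (s * ln t). The convention 0 powr s = 0 only affects the endpoints, a null set.
\<close>
definition E :: "complex \<Rightarrow> real \<Rightarrow> real \<Rightarrow> real \<Rightarrow> real \<Rightarrow> complex" where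
  "E m x y \<xi> \<eta> =
    (if Re m \<ge> 1 then
       - (complex_of_real \<xi> powr m / (2 * complex_of_real pi)) *
         integral {0..pi} (\<lambda>\<theta>. complex_of_real (sin \<theta>) powr (m - 1) /
           complex_of_real (bracket x y \<xi> \<eta> \<theta>) powr (m / 2))
     else
       - (complex_of_real \<xi> * complex_of_real x powr (1 - m) / (2 * complex_of_real pi)) *
         integral {0..pi} (\<lambda>\<theta>. complex_of_real (sin \<theta>) powr (1 - m) /
           complex_of_real (bracket x y \<xi> \<eta> \<theta>) powr (1 - m / 2)))"

end

theory Submission
  imports Defs
begin

text \<open>
  Both branches of the definition involve the same integral
  \<open>J = \<integral>\<^sub>0\<^sup>\<pi> sin \<theta> powr (n - 1) / (d\<^sup>2 + 4 a sin\<^sup>2 (\<theta>/2)) powr (n/2) d\<theta>\<close> with \<open>a = x \<xi>\<close>,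
  \<open>d\<close> the distance of the two points, and \<open>n = m\<close> or \<open>n = 2 - m\<close>, so that \<open>Re n \<ge> 1\<close>.
  Its integrand is within \<open>\<epsilon>/\<theta>\<close> of \<open>c/\<theta>\<close>, \<open>c = (x\<^sup>2) powr (- n/2)\<close>, on an interval \<open>[K d, \<eta>]\<close> with
  \<open>K, \<eta>\<close> independent of \<open>d\<close>, while \<open>[0, K d]\<close> and \<open>[\<eta>, \<pi>]\<close> contribute \<open>O(1)\<close>. Hence
  \<open>J \<sim> - c ln d\<close>, and the prefactors tend to \<open>- 1 / (2 \<pi> c)\<close>.
\<close>

section \<open>The kernel: size bound and integrability\<close>

text \<open>The parameters \<open>a\<close> and \<open>d\<close> are kept independent, although both
  come from the same pair of points, so that estimates in \<open>d\<close> can be made uniform for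
  \<open>a\<close> near its limit.\<close>

definition angular_kernel :: "complex \<Rightarrow> real \<Rightarrow> real \<Rightarrow> real \<Rightarrow> complex" where
  "angular_kernel n a d \<theta> = complex_of_real (sin \<theta>) powr (n - 1) /
     complex_of_real (d\<^sup>2 + 4 * a * (sin (\<theta> / 2))\<^sup>2) powr (n / 2)"

text \<open>The modulus of a power of a nonnegative base sees only the real part of the exponent,
  and \<open>Re n \<ge> 1\<close> makes both real exponents nonnegative. Hence the quotient grows
  with its numerator base and shrinks with its denominator base. The choices of \<open>P\<close> and
  \<open>Q\<close> serve the whole interval and each of the two outer pieces.\<close>

lemma norm_kernel_le:
  assumes "Re n \<ge> 1" "0 \<le> sin \<theta>" "sin \<theta> \<le> P" "0 < Q" "Q \<le> d\<^sup>2 + 4 * a * (sin (\<theta> / 2))\<^sup>2"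
  shows "norm (angular_kernel n a d \<theta>) \<le> P powr (Re n - 1) / Q powr (Re n / 2)"
proof -
  have "norm (angular_kernel n a d \<theta>) =
      sin \<theta> powr (Re n - 1) / (d\<^sup>2 + 4 * a * (sin (\<theta> / 2))\<^sup>2) powr (Re n / 2)"
    using assms unfolding angular_kernel_def norm_divide
    by (subst (1 2) norm_powr_real_powr) auto
  also have "\<dots> \<le> P powr (Re n - 1) / Q powr (Re n / 2)"
    using assms by (intro frac_le powr_mono2) auto
  finally show ?thesis .
qed

text \<open>The kernel is continuous on the open interval and bounded there because the bracket is
  at least \<open>d\<^sup>2\<close>. The endpoints are left out since \<open>sin\<close> vanishes
  there and continuity can fail: for \<open>n = 1\<close> the convention \<open>0 powr 0 = 0\<close>
  creates a jump.\<close>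

lemma kernel_integrable:
  assumes "Re n \<ge> 1" "a > 0" "d > 0"
  shows "angular_kernel n a d integrable_on {0..pi}"
proof -
  have pos: "d\<^sup>2 + 4 * a * (sin (\<theta> / 2))\<^sup>2 > 0" for \<theta>
    using assms by (intro add_pos_nonneg) auto
  have powr: "continuous_on {0<..<pi} (\<lambda>\<theta>. complex_of_real (f \<theta>) powr c)"
    if "continuous_on {0<..<pi} f" "\<And>\<theta>. \<theta> \<in> {0<..<pi} \<Longrightarrow> f \<theta> > 0" for f c
    using that less_imp_le[OF that(2)] less_imp_neq[OF that(2)]
    by (intro continuous_on_powr_complex continuous_on_of_real continuous_on_const) auto
  have "complex_of_real (d\<^sup>2 + 4 * a * (sin (\<theta> / 2))\<^sup>2) \<noteq> 0" for \<theta>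
    using pos[of \<theta>] by (metis of_real_eq_0_iff less_irrefl)
  then have "continuous_on {0<..<pi} (angular_kernel n a d)"
    unfolding angular_kernel_def using pos
    by (intro continuous_on_divide powr continuous_intros ballI)
       (simp_all add: sin_gt_zero powr_eq_0_iff del: of_real_add of_real_mult of_real_power)
  then have "angular_kernel n a d \<in> borel_measurable (lebesgue_on {0<..<pi})"
    by (intro continuous_imp_measurable_on_sets_lebesgue) auto
  moreover have "(\<lambda>_. 1 powr (Re n - 1) / (d\<^sup>2) powr (Re n / 2)) integrable_on {0<..<pi}"
    by (simp add: integrable_on_open_interval_real integrable_const_ivl)
  moreover have "norm (angular_kernel n a d \<theta>) \<le> 1 powr (Re n - 1) / (d\<^sup>2) powr (Re n / 2)"
    if "\<theta> \<in> {0<..<pi}" for \<theta>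
    using that assms by (intro norm_kernel_le) (auto intro!: sin_ge_zero)
  ultimately have "angular_kernel n a d integrable_on {0<..<pi}"
    by (rule measurable_bounded_by_integrable_imp_integrable) auto
  then show ?thesis
    by (simp add: integrable_on_open_interval_real)
qed

lemma norm_integral_bound:
  fixes f :: "real \<Rightarrow> 'a::banach"
  assumes "a \<le> b" "f integrable_on {a..b}" "\<And>t. t \<in> {a..b} \<Longrightarrow> norm (f t) \<le> B"
  shows "norm (integral {a..b} f) \<le> B * (b - a)"
  using integral_norm_bound_integral[of f "{a..b}" "\<lambda>_. B"] assms
  by (simp add: integrable_const_ivl mult.commute)

section \<open>Behaviour of the kernel at small angles\<close>

text \<open>Absorbing the n-th power of \<open>sin \<theta>\<close> into the bracket turns the
  bracket into its quotient by \<open>(sin \<theta>)\<^sup>2\<close>. What remains depends on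
  \<open>d\<close> only through \<open>d / \<theta>\<close> and has a limit as \<theta>,
  \<open>d / \<theta>\<close> and \<open>a\<close> vary jointly.\<close>

lemma kernel_times_angle:
  assumes "0 < \<theta>" "\<theta> < pi" "a > 0" "d > 0"
  shows "\<theta> * angular_kernel n a d \<theta> =
    of_real (\<theta> / sin \<theta>) *
    of_real ((d / \<theta>)\<^sup>2 * (\<theta> / sin \<theta>)\<^sup>2 + a / (cos (\<theta> / 2))\<^sup>2) powr (- n / 2)"
proof -
  define b where "b = d\<^sup>2 + 4 * a * (sin (\<theta> / 2))\<^sup>2"
  have b: "b > 0"
    using assms unfolding b_def by (intro add_pos_nonneg) auto
  have s: "sin \<theta> > 0" using assms by (intro sin_gt_zero) auto
  have h: "sin (\<theta> / 2) > 0" using assms by (intro sin_gt_zero) auto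
  have "sin \<theta> = 2 * sin (\<theta> / 2) * cos (\<theta> / 2)"
    using sin_double[of "\<theta> / 2"] by simp
  then have "4 * a * (sin (\<theta> / 2))\<^sup>2 / (sin \<theta>)\<^sup>2 = a / (cos (\<theta> / 2))\<^sup>2"
    using h by (simp add: power2_eq_square)
  then have eq: "(d / \<theta>)\<^sup>2 * (\<theta> / sin \<theta>)\<^sup>2 + a / (cos (\<theta> / 2))\<^sup>2 = b / (sin \<theta>)\<^sup>2"
    using assms s by (simp add: b_def add_divide_distrib power_divide)
  \<comment> \<open>All bases are positive, so the complex powers can be split through real
    logarithms without any branch question.\<close>
  have "ln (b / (sin \<theta>)\<^sup>2) = ln b - 2 * ln (sin \<theta>)"
    using b s by (simp add: ln_div ln_realpow)
  then have "complex_of_real (b / (sin \<theta>)\<^sup>2) powr (- n / 2) =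
      exp (- n / 2 * (of_real (ln b) - 2 * of_real (ln (sin \<theta>))))"
    using b s by (simp add: powr_def Ln_of_real del: of_real_divide of_real_power)
  also have "\<dots> = exp (n * of_real (ln (sin \<theta>))) / exp (n / 2 * of_real (ln b))"
    by (simp add: algebra_simps flip: exp_diff)
  also have "\<dots> = complex_of_real (sin \<theta>) powr n / complex_of_real b powr (n / 2)"
    using b s by (simp add: powr_def Ln_of_real)
  also have "complex_of_real (sin \<theta>) powr n = sin \<theta> * complex_of_real (sin \<theta>) powr (n - 1)"
    using s by (simp add: powr_diff)
  finally show ?thesis
    unfolding eq angular_kernel_def b_def[symmetric] using s by simp
qed

text \<open>With \<open>u = d / \<theta>\<close> as a separate variable, a single joint limit gives
  uniformity in \<open>a\<close> and \<open>d\<close>: smallness of \<open>u\<close> is the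
  condition \<open>K * d \<le> \<theta>\<close>. The cap \<open>a0 / 2\<close> on \<rho> keeps
  \<open>a\<close> away from 0.\<close>

lemma kernel_times_angle_limit:
  assumes "a0 > 0" "\<epsilon> > 0"
  obtains \<eta> K \<rho> where "0 < \<eta>" "\<eta> < pi" "0 < K" "0 < \<rho>" "\<rho> \<le> a0 / 2"
    "\<And>a d \<theta>. \<bar>a - a0\<bar> < \<rho> \<Longrightarrow> 0 < d \<Longrightarrow> K * d \<le> \<theta> \<Longrightarrow> \<theta> \<le> \<eta> \<Longrightarrow>
       norm (\<theta> * angular_kernel n a d \<theta> - of_real a0 powr (- n / 2)) \<le> \<epsilon>"
proof -
  let ?g = "\<lambda>(\<theta>, u, a). complex_of_real (\<theta> / sin \<theta>) *
    complex_of_real (u\<^sup>2 * (\<theta> / sin \<theta>)\<^sup>2 + a / (cos (\<theta> / 2))\<^sup>2) powr (- n / 2)"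
  \<comment> \<open>Only \<theta> is restricted to one side and kept off its limit point; the
    product filter yields separate thresholds for the three variables.\<close>
  let ?F = "at_right (0::real) \<times>\<^sub>F (nhds (0::real) \<times>\<^sub>F nhds a0)"
  have 1: "LIM z ?F. fst z :> at_right 0"
    by (rule filterlim_fst)
  have 2: "((\<lambda>z. fst (snd z)) \<longlongrightarrow> 0) ?F" "((\<lambda>z. snd (snd z)) \<longlongrightarrow> a0) ?F"
    by (rule filterlim_compose[OF filterlim_fst filterlim_snd]
        filterlim_compose[OF filterlim_snd filterlim_snd])+
  have "((\<lambda>\<theta>::real. sin \<theta> / \<theta>) \<longlongrightarrow> 1) (at 0)"
    using DERIV_sin[of 0] by (simp add: DERIV_def)
  from tendsto_inverse[OF this] have "((\<lambda>\<theta>::real. \<theta> / sin \<theta>) \<longlongrightarrow> 1) (at_right 0)"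
    by (simp add: filterlim_at_split)
  note s = filterlim_compose[OF this 1]
  have "((\<lambda>\<theta>::real. cos (\<theta> / 2)) \<longlongrightarrow> 1) (at_right 0)"
    by (auto intro!: tendsto_eq_intros)
  note c = filterlim_compose[OF this 1]
  have "((\<lambda>z. complex_of_real (fst z / sin (fst z)) *
    complex_of_real ((fst (snd z))\<^sup>2 * (fst z / sin (fst z))\<^sup>2 + snd (snd z) / (cos (fst z / 2))\<^sup>2) powr (- n / 2))
     \<longlongrightarrow> of_real 1 * of_real (0\<^sup>2 * 1\<^sup>2 + a0 / 1\<^sup>2) powr (- n / 2)) ?F"
    using assms
    by (intro tendsto_intros s c 2) (auto simp: complex_nonpos_Reals_iff)
  then have "(?g \<longlongrightarrow> of_real a0 powr (- n / 2)) ?F"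
    by (simp add: case_prod_unfold)
  then have "\<forall>\<^sub>F z in ?F. dist (?g z) (of_real a0 powr (- n / 2)) < \<epsilon>"
    using \<open>\<epsilon> > 0\<close> by (rule tendstoD)
  then obtain P1 P2 P3 where P: "eventually P1 (at_right (0::real))" "eventually P2 (nhds (0::real))"
      "eventually P3 (nhds a0)"
      "\<And>\<theta> u a. P1 \<theta> \<Longrightarrow> P2 u \<Longrightarrow> P3 a \<Longrightarrow> dist (?g (\<theta>, u, a)) (of_real a0 powr (- n / 2)) < \<epsilon>"
    unfolding eventually_prod_filter by (smt (verit, best))
  obtain \<eta>' where e: "\<eta>' > 0" "\<And>\<theta>. 0 < \<theta> \<Longrightarrow> \<theta> < \<eta>' \<Longrightarrow> P1 \<theta>"
    using P(1) unfolding eventually_at_right_field by auto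
  obtain \<kappa> where k: "\<kappa> > 0" "\<And>u. \<bar>u\<bar> < \<kappa> \<Longrightarrow> P2 u"
    using P(2) unfolding eventually_nhds_metric by (auto simp: dist_real_def)
  obtain \<rho>' where r: "\<rho>' > 0" "\<And>a. \<bar>a - a0\<bar> < \<rho>' \<Longrightarrow> P3 a"
    using P(3) unfolding eventually_nhds_metric by (auto simp: dist_real_def)
  show thesis
  \<comment> \<open>Halving \<open>\<eta>'\<close> and taking \<open>2 / \<kappa>\<close> turn the
    strict bounds into closed ones: \<open>2 / \<kappa> * d \<le> \<theta>\<close> gives
    \<open>d / \<theta> \<le> \<kappa> / 2\<close>. The minimum with 1 keeps the cut-off below
    \<open>pi\<close>.\<close>
  proof (rule that[of "min (\<eta>' / 2) 1" "2 / \<kappa>" "min \<rho>' (a0 / 2)"])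
    fix a d \<theta> :: real
    assume A: "\<bar>a - a0\<bar> < min \<rho>' (a0 / 2)" "0 < d" "2 / \<kappa> * d \<le> \<theta>" "\<theta> \<le> min (\<eta>' / 2) 1"
    have "0 < 2 / \<kappa> * d" using A k by simp
    then have t: "0 < \<theta>" "\<theta> < \<eta>'" "\<theta> < pi" "a > 0"
      using A e pi_gt3 assms(1) by linarith+
    have "2 * d \<le> \<theta> * \<kappa>" using A(3) k by (simp add: field_simps)
    then have "d < \<kappa> * \<theta>" using A by (simp add: mult.commute)
    then have "\<bar>d / \<theta>\<bar> < \<kappa>" using t A by (simp add: pos_divide_less_eq)
    then have "dist (?g (\<theta>, d / \<theta>, a)) (of_real a0 powr (- n / 2)) < \<epsilon>"
      using A t e k r by (intro P(4)) auto
    then show "norm (\<theta> * angular_kernel n a d \<theta> - of_real a0 powr (- n / 2)) \<le> \<epsilon>"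
      using kernel_times_angle[OF t(1,3,4) A(2), of n] by (simp add: dist_norm)
  qed (use e k r assms pi_gt3 in auto)
qed

section \<open>Logarithmic growth of the integral\<close>

text \<open>The interval is cut at \<open>K * d\<close> and \<eta>. The middle piece is compared
  with the integral of \<open>c / \<theta>\<close>, which produces the logarithm; everything else is
  bounded by an \<open>M\<close> that may depend on \<epsilon> but not on \<open>a\<close> or
  \<open>d\<close>.\<close>

lemma kernel_integral_estimate:
  assumes "Re n \<ge> 1" "a0 > 0" "\<epsilon> > 0"
  obtains M \<rho> \<tau> where "0 < \<rho>" "0 < \<tau>"
    "\<And>a d. \<bar>a - a0\<bar> < \<rho> \<Longrightarrow> 0 < d \<Longrightarrow> d < \<tau> \<Longrightarrow>
       norm (integral {0..pi} (angular_kernel n a d) + of_real a0 powr (- n / 2) * ln d) \<le> \<epsilon> * - ln d + M"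
proof -
  define c where "c = complex_of_real a0 powr (- n / 2)"
  obtain \<eta> K \<rho> where par: "0 < \<eta>" "\<eta> < pi" "0 < K" "0 < \<rho>" "\<rho> \<le> a0 / 2"
    and mid: "\<And>a d \<theta>. \<bar>a - a0\<bar> < \<rho> \<Longrightarrow> 0 < d \<Longrightarrow> K * d \<le> \<theta> \<Longrightarrow> \<theta> \<le> \<eta> \<Longrightarrow>
       norm (\<theta> * angular_kernel n a d \<theta> - c) \<le> \<epsilon>"
    unfolding c_def using kernel_times_angle_limit[OF assms(2,3)] by metis
  \<comment> \<open>A lower bound for the bracket on \<open>{\<eta>..pi}\<close>, from
    \<open>2 * a0 \<le> 4 * a\<close> and the monotonicity of \<open>sin (\<theta> / 2)\<close>
    there.\<close>
  define Q where "Q = 2 * a0 * (sin (\<eta> / 2))\<^sup>2"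
  have "sin (\<eta> / 2) > 0" using par by (intro sin_gt_zero) auto
  then have Q: "Q > 0" using assms by (simp add: Q_def)
  define l where "l = ln \<eta> - ln K"
  define B where "B = 1 / Q powr (Re n / 2)"
  have B: "B \<ge> 0" by (simp add: B_def)
  show thesis
  \<comment> \<open>The bound \<open>d < \<eta> / K\<close> puts the cuts in order. The summands of
    \<open>M\<close> come from the first piece, the last piece, and the bounded part
    \<open>l\<close> of \<open>L = l - ln d\<close>.\<close>
  proof (rule that[of \<rho> "\<eta> / K" "K powr Re n + B * pi + (\<epsilon> + norm c) * \<bar>l\<bar>"])
    fix a d :: real
    assume A: "\<bar>a - a0\<bar> < \<rho>" "0 < d" "d < \<eta> / K"
    have a: "2 * a0 \<le> 4 * a" using A par by linarith
    then have "a > 0" using assms by linarith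
    let ?f = "angular_kernel n a d"
    have Kd: "0 < K * d" "K * d < \<eta>" using A par by (auto simp: field_simps)
    have int: "?f integrable_on {0..pi}"
      using assms \<open>a > 0\<close> A by (intro kernel_integrable)
    then have int': "?f integrable_on {u..v}" if "0 \<le> u" "v \<le> pi" for u v
      by (rule integrable_on_subinterval) (use that in auto)
    have split: "integral {0..pi} ?f =
        integral {0..K * d} ?f + integral {K * d..\<eta>} ?f + integral {\<eta>..pi} ?f"
      using Kd par int int'[of 0 \<eta>]
      by (simp add: Henstock_Kurzweil_Integration.integral_combine)
    \<comment> \<open>Here \<open>sin \<theta> \<le> \<theta> \<le> K * d\<close> and the bracket is
      at least \<open>d\<^sup>2\<close>. Multiplied by the length \<open>K * d\<close>, the powers
      of \<open>d\<close> cancel exactly.\<close>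
    have "norm (integral {0..K * d} ?f) \<le> ((K * d) powr (Re n - 1) / (d\<^sup>2) powr (Re n / 2)) * (K * d - 0)"
    proof (rule norm_integral_bound)
      show "?f integrable_on {0..K * d}" using Kd par by (intro int') auto
      fix \<theta> assume \<theta>: "\<theta> \<in> {0..K * d}"
      show "norm (?f \<theta>) \<le> (K * d) powr (Re n - 1) / (d\<^sup>2) powr (Re n / 2)"
        using assms A \<open>a > 0\<close> \<theta> par Kd sin_x_le_x[of \<theta>]
        by (intro norm_kernel_le) (auto intro!: sin_ge_zero)
    qed (use Kd in auto)
    also have "\<dots> = K powr Re n"
    proof -
      have "(d\<^sup>2) powr (Re n / 2) = d powr Re n"
        using A by (simp add: powr_powr flip: powr_numeral)
      moreover have "(K * d) powr (Re n - 1) * (K * d) = (K * d) powr Re n"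
        using Kd by (simp add: powr_diff)
      ultimately show ?thesis
        using A par by (simp add: powr_mult)
    qed
    finally have 1: "norm (integral {0..K * d} ?f) \<le> K powr Re n" .
    have "norm (integral {\<eta>..pi} ?f) \<le> B * (pi - \<eta>)"
    proof (rule norm_integral_bound)
      show "?f integrable_on {\<eta>..pi}" using par by (intro int') auto
      fix \<theta> assume \<theta>: "\<theta> \<in> {\<eta>..pi}"
      have "sin (\<eta> / 2) \<le> sin (\<theta> / 2)"
        using \<theta> par by (intro sin_monotone_2pi_le) auto
      then have "(sin (\<eta> / 2))\<^sup>2 \<le> (sin (\<theta> / 2))\<^sup>2"
        using \<open>sin (\<eta> / 2) > 0\<close> by (intro power_mono) auto
      then have "2 * a0 * (sin (\<eta> / 2))\<^sup>2 \<le> 4 * a * (sin (\<theta> / 2))\<^sup>2"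
        using assms \<open>a > 0\<close> by (intro mult_mono[OF a]) auto
      then have "Q \<le> d\<^sup>2 + 4 * a * (sin (\<theta> / 2))\<^sup>2"
        unfolding Q_def by (smt (verit) zero_le_power2)
      then have "norm (?f \<theta>) \<le> 1 powr (Re n - 1) / Q powr (Re n / 2)"
        using assms \<theta> par Q by (intro norm_kernel_le) (auto intro!: sin_ge_zero)
      then show "norm (?f \<theta>) \<le> B" by (simp add: B_def)
    qed (use par in auto)
    also have "\<dots> \<le> B * pi" using B par by (intro mult_left_mono) auto
    finally have 3: "norm (integral {\<eta>..pi} ?f) \<le> B * pi" .
    define L where "L = ln \<eta> - ln (K * d)"
    have inv: "((\<lambda>\<theta>. 1 / \<theta>) has_integral L) {K * d..\<eta>}"
      unfolding L_def using Kd
      by (intro fundamental_theorem_of_calculus)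
         (auto intro!: derivative_eq_intros simp flip: has_real_derivative_iff_has_vector_derivative)
    then have cinv: "((\<lambda>\<theta>. c * of_real (1 / \<theta>)) has_integral c * of_real L) {K * d..\<eta>}"
      by (intro has_integral_mult_right has_integral_of_real)
    have "(?f has_integral integral {K * d..\<eta>} ?f) {K * d..\<eta>}"
      using Kd par by (intro integrable_integral int') auto
    \<comment> \<open>The majorant is \<open>\<epsilon> / \<theta>\<close>, with integral
      \<open>\<epsilon> * L\<close>. The inner product with 1 is the component form of the bound and
      leaves a real number unchanged.\<close>
    from has_integral_diff[OF this cinv]
    have "norm (integral {K * d..\<eta>} ?f - c * of_real L) \<le> (\<epsilon> * L) \<bullet> 1"
    proof (rule has_integral_norm_bound_integral_component)
      show "((\<lambda>\<theta>. \<epsilon> * (1 / \<theta>)) has_integral \<epsilon> * L) {K * d..\<eta>}"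
        by (intro has_integral_mult_right inv)
      fix \<theta> assume \<theta>: "\<theta> \<in> {K * d..\<eta>}"
      then have t: "\<theta> > 0" using Kd by auto
      have "?f \<theta> - c * of_real (1 / \<theta>) = (\<theta> * ?f \<theta> - c) / \<theta>"
        using t by (simp add: field_simps)
      moreover have "norm (\<theta> * ?f \<theta> - c) / \<theta> \<le> \<epsilon> / \<theta>"
        using mid[OF A(1,2), of \<theta>] \<theta> t by (intro divide_right_mono) auto
      ultimately show "norm (?f \<theta> - c * of_real (1 / \<theta>)) \<le> (\<epsilon> * (1 / \<theta>)) \<bullet> 1"
        using t by (simp add: norm_divide)
    qed
    then have 2: "norm (integral {K * d..\<eta>} ?f - c * of_real L) \<le> \<epsilon> * L" by simp
    have L: "L = l - ln d"
      using A par by (simp add: L_def l_def ln_mult)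
    have "integral {0..pi} ?f + c * ln d =
        integral {0..K * d} ?f + (integral {K * d..\<eta>} ?f - c * of_real L) +
        integral {\<eta>..pi} ?f + c * of_real l"
      by (simp add: split L algebra_simps)
    also have "norm \<dots> \<le> K powr Re n + \<epsilon> * L + B * pi + norm (c * of_real l)"
      by (intro norm_triangle_mono 1 2 3 order_refl)
    also have "\<dots> \<le> \<epsilon> * - ln d + (K powr Re n + B * pi + (\<epsilon> + norm c) * \<bar>l\<bar>)"
      using assms mult_left_mono[of l "\<bar>l\<bar>" \<epsilon>] by (simp add: L norm_mult algebra_simps)
    finally show "norm (integral {0..pi} ?f + of_real a0 powr (- n / 2) * ln d) \<le>
        \<epsilon> * - ln d + (K powr Re n + B * pi + (\<epsilon> + norm c) * \<bar>l\<bar>)"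
      by (simp only: c_def)
  qed (use par in auto)
qed

text \<open>The estimate is applied with half the tolerance and divided by \<open>- ln d\<close>.
  Since \<open>M\<close> is then fixed while \<open>- ln d\<close> tends to infinity, its share
  eventually falls below the other half.\<close>

lemma kernel_integral_limit:
  assumes "Re n \<ge> 1" "a0 > 0" and a: "(a \<longlongrightarrow> a0) F" and d: "filterlim d (at_right 0) F"
  shows "((\<lambda>z. integral {0..pi} (angular_kernel n (a z) (d z)) / - ln (d z)) \<longlongrightarrow>
    of_real a0 powr (- n / 2)) F"
proof (rule tendstoI)
  fix e :: real assume "e > 0"
  then have "e / 2 > 0" by simp
  from kernel_integral_estimate[OF assms(1,2) this]
  obtain M \<rho> \<tau> where par: "0 < \<rho>" "0 < \<tau>"
    and est: "\<And>a d. \<bar>a - a0\<bar> < \<rho> \<Longrightarrow> 0 < d \<Longrightarrow> d < \<tau> \<Longrightarrow>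
       norm (integral {0..pi} (angular_kernel n a d) + of_real a0 powr (- n / 2) * ln d) \<le> e / 2 * - ln d + M"
    by metis
  have "filterlim (\<lambda>z. - ln (d z)) at_top F"
    using filterlim_compose[OF ln_at_0 d] by (simp add: filterlim_uminus_at_top)
  then have "((\<lambda>z. M / - ln (d z)) \<longlongrightarrow> 0) F"
    by (intro tendsto_divide_0[OF tendsto_const] filterlim_at_top_imp_at_infinity)
  then have "\<forall>\<^sub>F z in F. M / - ln (d z) < e / 2"
    using \<open>e / 2 > 0\<close> by (rule order_tendstoD)
  moreover have "\<forall>\<^sub>F z in F. \<bar>a z - a0\<bar> < \<rho>"
    using tendstoD[OF a par(1)] by (simp add: dist_real_def)
  \<comment> \<open>The bound 1 makes \<open>- ln d\<close> positive, so that dividing by it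
    preserves inequalities.\<close>
  moreover have "\<forall>\<^sub>F t in at_right 0. 0 < t \<and> t < min \<tau> (1::real)"
    unfolding eventually_at_right_field using par by (intro exI[of _ "min \<tau> 1"]) auto
  then have "\<forall>\<^sub>F z in F. 0 < d z \<and> d z < min \<tau> 1"
    using d by (auto simp: filterlim_iff)
  ultimately show "\<forall>\<^sub>F z in F. dist (integral {0..pi} (angular_kernel n (a z) (d z)) / - ln (d z))
      (of_real a0 powr (- n / 2)) < e"
  proof eventually_elim
    case (elim z)
    let ?J = "integral {0..pi} (angular_kernel n (a z) (d z))" and ?c = "complex_of_real a0 powr (- n / 2)"
    have l: "- ln (d z) > 0" using elim by simp
    have "?J / - ln (d z) - ?c = (?J + ?c * ln (d z)) / complex_of_real (- ln (d z))"
      using l by (simp add: field_simps)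
    then have "dist (?J / - ln (d z)) ?c = norm (?J + ?c * ln (d z)) / - ln (d z)"
      using l by (simp add: dist_norm norm_divide del: of_real_minus)
    also have "\<dots> \<le> (e / 2 * - ln (d z) + M) / - ln (d z)"
      using l elim by (intro divide_right_mono est) auto
    also have "\<dots> = e / 2 + M / - ln (d z)"
      using l by (simp add: field_simps)
    also have "\<dots> < e" using elim(1) by linarith
    finally show ?case .
  qed
qed

section \<open>Return to \<open>E\<close> and the asymptotic equivalence\<close>

text \<open>The second branch is the kernel with \<open>n = 2 - m\<close>, for then
  \<open>n - 1 = 1 - m\<close> and \<open>n / 2 = 1 - m / 2\<close>; moreover
  \<open>Re m < 1\<close> gives \<open>Re n > 1\<close>, so one limit lemma covers both
  branches.\<close>

lemma E_eq_kernel_integral: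
  fixes m :: complex
  shows "E m x y \<xi> \<eta> =
    (if Re m \<ge> 1 then
       - (of_real \<xi> powr m / (2 * pi)) *
         integral {0..pi} (angular_kernel m (x * \<xi>) (sqrt ((x - \<xi>)\<^sup>2 + (y - \<eta>)\<^sup>2)))
     else
       - (\<xi> * of_real x powr (1 - m) / (2 * pi)) *
         integral {0..pi} (angular_kernel (2 - m) (x * \<xi>) (sqrt ((x - \<xi>)\<^sup>2 + (y - \<eta>)\<^sup>2))))"
proof -
  have "bracket x y \<xi> \<eta> \<theta> =
      (sqrt ((x - \<xi>)\<^sup>2 + (y - \<eta>)\<^sup>2))\<^sup>2 + 4 * (x * \<xi>) * (sin (\<theta> / 2))\<^sup>2" for \<theta>
    by (simp add: bracket_def)
  moreover have "2 - m - 1 = 1 - m" "(2 - m) / 2 = 1 - m / 2"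
    by (simp_all add: diff_divide_distrib)
  ultimately show ?thesis
    by (simp only: E_def angular_kernel_def[abs_def] of_real_mult of_real_numeral)
qed

theorem proposition4p2:
  fixes m :: complex and x y :: real
  assumes "(x, y) \<in> half_plane"
  shows "(\<lambda>(\<xi>, \<eta>). E m x y \<xi> \<eta>) \<sim>[at (x, y) within half_plane]
         (\<lambda>(\<xi>, \<eta>). complex_of_real (1 / (2 * pi) * ln (sqrt ((x - \<xi>)\<^sup>2 + (y - \<eta>)\<^sup>2))))"
proof (rule asymp_equivI')
  let ?F = "at (x, y) within half_plane"
  define d where "d = (\<lambda>z. sqrt ((x - fst z)\<^sup>2 + (y - snd z)\<^sup>2))"
  have x: "x > 0" using assms by (simp add: half_plane_def)
  have fst: "(fst \<longlongrightarrow> x) ?F" and snd: "(snd \<longlongrightarrow> y) ?F"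
    using tendsto_fst[OF tendsto_ident_at[of "(x, y)" half_plane]]
      tendsto_snd[OF tendsto_ident_at[of "(x, y)" half_plane]] by simp_all
  have "(d \<longlongrightarrow> sqrt ((x - x)\<^sup>2 + (y - y)\<^sup>2)) ?F"
    unfolding d_def by (intro tendsto_intros fst snd)
  \<comment> \<open>The punctured neighbourhood excludes the point itself, so the distance tends to
    0 strictly from the right.\<close>
  moreover have "\<forall>\<^sub>F z in ?F. d z > 0"
    using eventually_neq_at_within[of "(x, y)" "(x, y)" half_plane]
    by eventually_elim (auto simp: d_def sum_power2_gt_zero_iff prod_eq_iff)
  ultimately have d: "filterlim d (at_right 0) ?F"
    by (simp add: tendsto_imp_filterlim_at_right)
  have a: "((\<lambda>z. x * fst z) \<longlongrightarrow> x * x) ?F"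
    by (intro tendsto_intros fst)
  have sq: "complex_of_real (x * x) powr (- n / 2) = of_real x powr (- n)" for n
  proof -
    have "Ln (complex_of_real (x * x)) = 2 * complex_of_real (ln x)"
      using x by (subst Ln_of_real) (simp_all add: ln_mult)
    then show ?thesis
      using x by (simp add: powr_def Ln_of_real)
  qed
  show "((\<lambda>z. (case z of (\<xi>, \<eta>) \<Rightarrow> E m x y \<xi> \<eta>) /
      (case z of (\<xi>, \<eta>) \<Rightarrow> complex_of_real (1 / (2 * pi) * ln (sqrt ((x - \<xi>)\<^sup>2 + (y - \<eta>)\<^sup>2)))))
      \<longlongrightarrow> 1) ?F"
  proof (cases "Re m \<ge> 1")
    case True
    \<comment> \<open>In the quotient the constants \<open>1 / (2 * pi)\<close> cancel and the minus
      sign of \<open>E\<close> moves to the logarithm. The prefactor tends to the reciprocal of the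
      limit of the normalized integral.\<close>
    have "((\<lambda>z. of_real (fst z) powr m *
        (integral {0..pi} (angular_kernel m (x * fst z) (d z)) / - ln (d z))) \<longlongrightarrow>
        of_real x powr m * of_real (x * x) powr (- m / 2)) ?F"
      using x True by (intro tendsto_intros fst kernel_integral_limit a d)
        (auto simp: complex_nonpos_Reals_iff)
    also have "complex_of_real x powr m * of_real (x * x) powr (- m / 2) = 1"
      using x unfolding sq by (simp flip: powr_add)
    finally show ?thesis
      using True by (simp add: E_eq_kernel_integral case_prod_unfold d_def)
  next
    case False
    \<comment> \<open>The same cancellation with \<open>n = 2 - m\<close>: the exponents of
      \<open>x\<close> are 1, \<open>1 - m\<close> and \<open>- (2 - m)\<close>, with sum 0.\<close>
    have "((\<lambda>z. of_real (fst z) * of_real x powr (1 - m) *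
        (integral {0..pi} (angular_kernel (2 - m) (x * fst z) (d z)) / - ln (d z))) \<longlongrightarrow>
        of_real x * of_real x powr (1 - m) * of_real (x * x) powr (- (2 - m) / 2)) ?F"
      using x False by (intro tendsto_intros fst kernel_integral_limit a d) auto
    also have "of_real x * of_real x powr (1 - m) * of_real (x * x) powr (- (2 - m) / 2) =
        complex_of_real x powr (1 + (1 - m) + - (2 - m))"
      using x unfolding sq powr_add by simp
    also have "\<dots> = 1" using x by simp
    finally show ?thesis
      using False by (simp add: E_eq_kernel_integral case_prod_unfold d_def)
  qed
qed

end
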